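(* Let $G=(V,E)$ be a graph with inductive independence number $\rho\ge 1$, let $\pi$ be an ordering of $V$ witnessing $\rho$, let $k\in\mathbb{N}$, and let $b\colon V\times 2^{[k]}\to\mathbb{N}$ be a valuation function. Let $x^\ast$ be any feasible solution of the linear program \[ \max \sum_{v\in V}\sum_{T\subseteq[k]} b_{v,T}x_{v,T}\quad\text{s.t.}\quad \sum_{u\in\Gamma_\pi(v)}\sum_{T\subseteq[k],\,j\in T}x_{u,T}\le\rho\ (\forall v\in V, j\in[k]),\quad \sum_{T\subseteq[k]}x_{v,T}\le 1\ (\forall v\in V),\quad x_{v,T}\ge 0, \] with objective value $b^\ast$. Consider the following randomized algorithm. Decompose $x^\ast$ into $x^{(1)}$ and $x^{(2)}=x^\ast-x^{(1)}$, where $x^{(1)}_{v,T}=x^\ast_{v,T}$ if $|T|\le\sqrt{k}$ and $x^{(1)}_{v,T}=0$ otherwise. For each $l\in\{1,2\}$: (rounding stage) for each $v\in V$ independently, set $S^{(l)}(v):=T$ with probability $x^{(l)}_{v,T}/(2\sqrt{k}\rho)$ for each nonempty $T\subseteq[k]$ (these events being mutually exclusive), and $S^{(l)}(v):=\emptyset$ with the remaining probability; (conflict-resolution stage) then go through the vertices $v\in V$ and, for each $u\in\Gamma_\pi(v)$ with $S^{(l)}(u)\cap S^{(l)}(v)\neq\emptyset$ (with respect to the current values), set $S^{(l)}(v):=\emptyset$. Finally output whichever of $S^{(1)},S^{(2)}$ has larger social welfare. Then the output $S$ is a feasible allocation and its expected social welfare satisfies $\mathbb{E}[b(S)]\ge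 b^\ast/(8\sqrt{k}\rho)$.
   Context: $[k]=\{1,\dots,k\}$. An allocation is a map $S\colon V\to 2^{[k]}$; it is feasible if for every channel $j\in[k]$ the set $\{v\in V\mid j\in S(v)\}$ is an independent set of $G$. The social welfare is $b(S)=\sum_{v\in V}b_{v,S(v)}$. For an ordering (bijection) $\pi\colon V\to\{1,\dots,|V|\}$, $\Gamma_\pi(v)=\{u\in V\mid\{u,v\}\in E,\ \pi(u)<\pi(v)\}$. The inductive independence number $\rho$ of $G$ is the smallest number such that there is an ordering $\pi$ with $|M\cap\Gamma_\pi(v)|\le\rho$ for all $v\in V$ and all independent sets $M\subseteq V$; such a $\pi$ witnesses $\rho$. *)

theory Defs
  imports "HOL-Probability.Probability" "HOL-Library.Ramsey"
begin

definition simple_graph :: "'v set \<Rightarrow> 'v set set \<Rightarrow> bool" where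
  "simple_graph V E \<longleftrightarrow> finite V \<and> E \<subseteq> nsets V 2"

definition independent_set :: "'v set \<Rightarrow> 'v set set \<Rightarrow> 'v set \<Rightarrow> bool" where
  "independent_set V E M \<longleftrightarrow> M \<subseteq> V \<and> indep M E"

definition vertex_ordering :: "'v set \<Rightarrow> ('v \<Rightarrow> nat) \<Rightarrow> bool" where
  "vertex_ordering V \<pi> \<longleftrightarrow> bij_betw \<pi> V {1..card V}"

definition backward_nbrs ::
  "'v set \<Rightarrow> 'v set set \<Rightarrow> ('v \<Rightarrow> nat) \<Rightarrow> 'v \<Rightarrow> 'v set" where
  "backward_nbrs V E \<pi> v = {u \<in> V. {u, v} \<in> E \<and> \<pi> u < \<pi> v}"

definition ordering_bounded_by ::
  "'v set \<Rightarrow> 'v set set \<Rightarrow> ('v \<Rightarrow> nat) \<Rightarrow> nat \<Rightarrow> bool" where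
  "ordering_bounded_by V E \<pi> r \<longleftrightarrow>
     vertex_ordering V \<pi> \<and>
     (\<forall>v\<in>V. \<forall>M. independent_set V E M \<longrightarrow> card (M \<inter> backward_nbrs V E \<pi> v) \<le> r)"

definition inductive_independence_number :: "'v set \<Rightarrow> 'v set set \<Rightarrow> nat" where
  "inductive_independence_number V E = (LEAST r. \<exists>\<pi>. ordering_bounded_by V E \<pi> r)"

definition feasible_allocation ::
  "'v set \<Rightarrow> 'v set set \<Rightarrow> nat \<Rightarrow> ('v \<Rightarrow> nat set) \<Rightarrow> bool" where
  "feasible_allocation V E k S \<longleftrightarrow>
     (\<forall>v\<in>V. S v \<subseteq> {1..k}) \<and> (\<forall>j\<in>{1..k}. independent_set V E {v \<in> V. j \<in> S v})"

definition social_welfare ::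
  "'v set \<Rightarrow> ('v \<Rightarrow> nat set \<Rightarrow> nat) \<Rightarrow> ('v \<Rightarrow> nat set) \<Rightarrow> nat" where
  "social_welfare V b S = (\<Sum>v\<in>V. b v (S v))"

definition LP_feasible ::
  "'v set \<Rightarrow> 'v set set \<Rightarrow> ('v \<Rightarrow> nat) \<Rightarrow> nat \<Rightarrow> nat \<Rightarrow> ('v \<Rightarrow> nat set \<Rightarrow> real) \<Rightarrow> bool" where
  "LP_feasible V E \<pi> k \<rho> x \<longleftrightarrow>
     (\<forall>v\<in>V. \<forall>j\<in>{1..k}.
        (\<Sum>u\<in>backward_nbrs V E \<pi> v. \<Sum>T\<in>{T. T \<subseteq> {1..k} \<and> j \<in> T}. x u T) \<le> real \<rho>) \<and>
     (\<forall>v\<in>V. (\<Sum>T\<in>Pow {1..k}. x v T) \<le> 1) \<and>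
     (\<forall>v\<in>V. \<forall>T\<in>Pow {1..k}. 0 \<le> x v T)"

definition LP_objective ::
  "'v set \<Rightarrow> nat \<Rightarrow> ('v \<Rightarrow> nat set \<Rightarrow> nat) \<Rightarrow> ('v \<Rightarrow> nat set \<Rightarrow> real) \<Rightarrow> real" where
  "LP_objective V k b x = (\<Sum>v\<in>V. \<Sum>T\<in>Pow {1..k}. real (b v T) * x v T)"

definition small_part ::
  "nat \<Rightarrow> ('v \<Rightarrow> nat set \<Rightarrow> real) \<Rightarrow> 'v \<Rightarrow> nat set \<Rightarrow> real" where
  "small_part k x v T = (if real (card T) \<le> sqrt (real k) then x v T else 0)"

definition large_part ::
  "nat \<Rightarrow> ('v \<Rightarrow> nat set \<Rightarrow> real) \<Rightarrow> 'v \<Rightarrow> nat set \<Rightarrow> real" where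
  "large_part k x v T = x v T - small_part k x v T"

definition round_prob :: "nat \<Rightarrow> nat \<Rightarrow> (nat set \<Rightarrow> real) \<Rightarrow> nat set \<Rightarrow> real" where
  "round_prob k \<rho> y T =
     (if T = {} then 1 - (\<Sum>T'\<in>Pow {1..k} - {{}}. y T' / (2 * sqrt (real k) * real \<rho>))
      else if T \<subseteq> {1..k} then y T / (2 * sqrt (real k) * real \<rho>)
      else 0)"

definition round_vertex :: "nat \<Rightarrow> nat \<Rightarrow> (nat set \<Rightarrow> real) \<Rightarrow> nat set pmf" where
  "round_vertex k \<rho> y = embed_pmf (round_prob k \<rho> y)"

text \<open>
  The side conditions of \<^const>\<open>embed_pmf\<close> hold for both parts of any LP-feasible
  solution, so \<^const>\<open>round_vertex\<close> has the intended point probabilities there.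
\<close>

lemma pmf_round_vertex:
  assumes nonneg: "\<And>T. T \<subseteq> {1..k} \<Longrightarrow> 0 \<le> y T"
    and le1: "(\<Sum>T\<in>Pow {1..k}. y T) \<le> 1" and "\<rho> \<ge> 1"
  shows "pmf (round_vertex k \<rho> y) T = round_prob k \<rho> y T"
proof -
  define c where "c = 2 * sqrt (real k) * real \<rho>"
  define s where "s = (\<Sum>T'\<in>Pow {1..k} - {{}}. y T' / c)"
  have c0: "c \<ge> 0" by (simp add: c_def)
  have s_le: "s \<le> 1"
  proof (cases "k = 0")
    case True
    then show ?thesis by (simp add: s_def)
  next
    case False
    then have "sqrt (real k) \<ge> 1" by simp
    with \<open>\<rho> \<ge> 1\<close> have c1: "1 \<le> c"
      using mult_mono[of 1 "sqrt (real k)" 1 "real \<rho>"] by (simp add: c_def)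
    have "s \<le> (\<Sum>T'\<in>Pow {1..k} - {{}}. y T')"
      unfolding s_def
    proof (rule sum_mono)
      fix T' assume "T' \<in> Pow {1..k} - {{}}"
      then have "0 \<le> y T'" by (intro nonneg) auto
      then have "y T' * 1 \<le> y T' * c" by (intro mult_left_mono c1)
      then show "y T' / c \<le> y T'" using c1 by (simp add: field_simps)
    qed
    also have "\<dots> \<le> (\<Sum>T'\<in>Pow {1..k}. y T')"
      by (rule sum_mono2) (auto intro: nonneg)
    finally show ?thesis using le1 by simp
  qed
  have eq: "round_prob k \<rho> y T =
      (if T = {} then 1 - s else if T \<subseteq> {1..k} then y T / c else 0)" for T
    by (simp add: round_prob_def s_def c_def)
  have pos: "0 \<le> round_prob k \<rho> y T" for T
    using s_le c0 nonneg by (auto simp: eq)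
  have "(\<integral>\<^sup>+ T. ennreal (round_prob k \<rho> y T) \<partial>count_space UNIV) =
        (\<integral>\<^sup>+ T. ennreal (round_prob k \<rho> y T) \<partial>count_space (Pow {1..k}))"
    by (rule nn_integral_count_space_eq) (auto simp: eq)
  also have "\<dots> = ennreal (\<Sum>T\<in>Pow {1..k}. round_prob k \<rho> y T)"
    by (simp add: nn_integral_count_space_finite pos)
  also have "(\<Sum>T\<in>Pow {1..k}. round_prob k \<rho> y T) =
      round_prob k \<rho> y {} + (\<Sum>T\<in>Pow {1..k} - {{}}. round_prob k \<rho> y T)"
    by (rule sum.remove) auto
  also have "(\<Sum>T\<in>Pow {1..k} - {{}}. round_prob k \<rho> y T) = s"
    unfolding s_def by (rule sum.cong) (auto simp: eq)
  finally have "(\<integral>\<^sup>+ T. ennreal (round_prob k \<rho> y T) \<partial>count_space UNIV) = 1"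
    by (simp add: eq)
  then show ?thesis
    unfolding round_vertex_def by (intro pmf_embed_pmf pos)
qed

definition rounding_stage ::
  "'v set \<Rightarrow> nat \<Rightarrow> nat \<Rightarrow> ('v \<Rightarrow> nat set \<Rightarrow> real) \<Rightarrow> ('v \<Rightarrow> nat set) pmf" where
  "rounding_stage V k \<rho> y = Pi_pmf V {} (\<lambda>v. round_vertex k \<rho> (y v))"

text \<open>
  Once \<open>S v\<close> has been emptied it meets no further \<open>S u\<close>, so looping over the
  \<open>u\<close> in the backward neighbourhood amounts to a single test.
\<close>

definition resolve_vertex ::
  "'v set \<Rightarrow> 'v set set \<Rightarrow> ('v \<Rightarrow> nat) \<Rightarrow> 'v \<Rightarrow> ('v \<Rightarrow> nat set) \<Rightarrow> 'v \<Rightarrow> nat set" where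
  "resolve_vertex V E \<pi> v S =
     (if \<exists>u\<in>backward_nbrs V E \<pi> v. S u \<inter> S v \<noteq> {} then S(v := {}) else S)"

text \<open>The list \<open>vs\<close> gives the order in which the vertices are visited; it need not be \<open>\<pi>\<close>.\<close>

definition resolve_conflicts ::
  "'v set \<Rightarrow> 'v set set \<Rightarrow> ('v \<Rightarrow> nat) \<Rightarrow> 'v list \<Rightarrow> ('v \<Rightarrow> nat set) \<Rightarrow> 'v \<Rightarrow> nat set" where
  "resolve_conflicts V E \<pi> vs S = fold (resolve_vertex V E \<pi>) vs S"

definition visiting_order :: "'v set \<Rightarrow> 'v list \<Rightarrow> bool" where
  "visiting_order V vs \<longleftrightarrow> distinct vs \<and> set vs = V"

definition round_and_resolve ::
  "'v set \<Rightarrow> 'v set set \<Rightarrow> ('v \<Rightarrow> nat) \<Rightarrow> nat \<Rightarrow> nat \<Rightarrow> 'v list \<Rightarrow>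
   ('v \<Rightarrow> nat set \<Rightarrow> real) \<Rightarrow> ('v \<Rightarrow> nat set) pmf" where
  "round_and_resolve V E \<pi> k \<rho> vs y =
     map_pmf (resolve_conflicts V E \<pi> vs) (rounding_stage V k \<rho> y)"

text \<open>
  The two runs use independent random choices. Ties between the two welfares are
  broken by the unspecified choice in \<^const>\<open>arg_max_on\<close>.
\<close>

definition LP_rounding ::
  "'v set \<Rightarrow> 'v set set \<Rightarrow> ('v \<Rightarrow> nat) \<Rightarrow> nat \<Rightarrow> nat \<Rightarrow> ('v \<Rightarrow> nat set \<Rightarrow> nat) \<Rightarrow>
   'v list \<Rightarrow> 'v list \<Rightarrow> ('v \<Rightarrow> nat set \<Rightarrow> real) \<Rightarrow> ('v \<Rightarrow> nat set) pmf" where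
  "LP_rounding V E \<pi> k \<rho> b vs1 vs2 x =
     do {
       S1 \<leftarrow> round_and_resolve V E \<pi> k \<rho> vs1 (small_part k x);
       S2 \<leftarrow> round_and_resolve V E \<pi> k \<rho> vs2 (large_part k x);
       return_pmf (arg_max_on (social_welfare V b) {S1, S2})
     }"

end

theory Submission
  imports Defs
begin

text \<open>
  A rounded vertex \<open>v\<close> with \<open>S v = T\<close> keeps its bundle if no backward neighbour was rounded to a
  bundle meeting \<open>T\<close>, whatever the visiting order, because values only shrink. By independence
  and a union bound, this fails with conditional probability at most \<open>1/2\<close>, provided the fractional
  weight of conflicting bundles in the backward neighbourhood is at most \<open>\<rho>\<surd>k\<close>. If \<open>T\<close> has at
  most \<open>\<surd>k\<close> channels, add up the LP constraints for the channels in \<open>T\<close>; if all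
  bundles have more than \<open>\<surd>k\<close> channels, add up the constraints for all \<open>k\<close> channels, where each
  bundle is counted more than \<open>\<surd>k\<close> times.
\<close>

section \<open>Conflict resolution\<close>

lemma fold_resolve_vertex_subset: "fold (resolve_vertex V E \<pi>) vs S w \<subseteq> S w"
proof (induction vs arbitrary: S)
  case (Cons a vs)
  have "resolve_vertex V E \<pi> a S w \<subseteq> S w"
    by (auto simp: resolve_vertex_def)
  with Cons[of "resolve_vertex V E \<pi> a S"] show ?case by auto
qed simp

text \<open>The hypothesis is an invariant of the fold: the test at \<open>v\<close> fails, so
  \<open>S v\<close> is unchanged, and a visit to any other vertex can only empty that
  vertex.\<close>

lemma fold_resolve_vertex_survives:
  assumes "\<forall>u\<in>backward_nbrs V E \<pi> v. S u \<inter> S v = {}"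
  shows "fold (resolve_vertex V E \<pi>) vs S v = S v"
  using assms
proof (induction vs arbitrary: S)
  case (Cons a vs)
  let ?S = "resolve_vertex V E \<pi> a S"
  have v: "?S v = S v"
    using Cons.prems by (auto simp: resolve_vertex_def)
  have "\<forall>u\<in>backward_nbrs V E \<pi> v. ?S u \<inter> ?S v = {}"
  proof
    fix u assume "u \<in> backward_nbrs V E \<pi> v"
    with Cons.prems have "S u \<inter> S v = {}" by blast
    moreover have "?S u \<subseteq> S u" by (auto simp: resolve_vertex_def)
    ultimately show "?S u \<inter> ?S v = {}" unfolding v by blast
  qed
  from Cons.IH[OF this] v show ?case by simp
qed simp

text \<open>The last visit to \<open>v\<close> either empties \<open>S v\<close> or finds it
  disjoint from \<open>S u\<close>. Later visits shrink both sets, so disjointness persists.\<close>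

lemma fold_resolve_vertex_disjoint:
  assumes "v \<in> set vs" and u: "u \<in> backward_nbrs V E \<pi> v"
  shows "fold (resolve_vertex V E \<pi>) vs S u \<inter> fold (resolve_vertex V E \<pi>) vs S v = {}"
  using assms(1)
proof (induction vs arbitrary: S)
  case (Cons a vs)
  show ?case
  proof (cases "v \<in> set vs")
    case True
    with Cons.IH show ?thesis by simp
  next
    case False
    with Cons.prems have a: "a = v" by simp
    have "resolve_vertex V E \<pi> v S u \<inter> resolve_vertex V E \<pi> v S v = {}"
      using u by (auto simp: resolve_vertex_def)
    with fold_resolve_vertex_subset[of V E \<pi> vs "resolve_vertex V E \<pi> v S"]
    show ?thesis unfolding a by (simp, blast)
  qed
qed simp

lemma feasible_resolve_conflicts:
  assumes ord: "vertex_ordering V \<pi>" and vs: "set vs = V"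
    and S: "\<And>v. v \<in> V \<Longrightarrow> S v \<subseteq> {1..k}"
  shows "feasible_allocation V E k (resolve_conflicts V E \<pi> vs S)"
proof -
  let ?R = "resolve_conflicts V E \<pi> vs S"
  have disj: "?R u \<inter> ?R v = {}" if "u \<in> V" "v \<in> V" "{u, v} \<in> E" "\<pi> u < \<pi> v" for u v
    unfolding resolve_conflicts_def
    by (rule fold_resolve_vertex_disjoint) (use that vs in \<open>auto simp: backward_nbrs_def\<close>)
  have inj: "inj_on \<pi> V"
    using ord by (simp add: vertex_ordering_def bij_betw_def)
  have "{u, v} \<notin> E" if "u \<in> V" "v \<in> V" "u \<noteq> v" "j \<in> ?R u" "j \<in> ?R v" for u v j
  proof
    assume e: "{u, v} \<in> E"
    \<comment> \<open>Injectivity of \<open>\<pi>\<close> orients every edge, so a conflict along it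
      is tested at the endpoint that comes later in \<open>\<pi>\<close>.\<close>
    from inj that have "\<pi> u < \<pi> v \<or> \<pi> v < \<pi> u"
      by (meson inj_onD linorder_neqE_nat)
    then show False
      using disj[of u v] disj[of v u] that e by (auto simp: insert_commute)
  qed
  moreover have "?R v \<subseteq> S v" for v
    unfolding resolve_conflicts_def by (rule fold_resolve_vertex_subset)
  ultimately show ?thesis
    using S unfolding feasible_allocation_def independent_set_def indep_def by blast
qed

section \<open>Rounding\<close>

lemma measure_Pi_pmf_pair:
  assumes "finite V" "u \<in> V" "v \<in> V" "u \<noteq> v"
  shows "measure_pmf.prob (Pi_pmf V d p) {S. S v \<in> A \<and> S u \<in> B} =
    measure_pmf.prob (p v) A * measure_pmf.prob (p u) B"
proof -
  \<comment> \<open>The event is a box over \<open>V\<close>; the sides outside \<open>u\<close> and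
    \<open>v\<close> are \<open>UNIV\<close> and contribute factors 1.\<close>
  let ?B = "\<lambda>w. if w = v then A else if w = u then B else UNIV"
  have "{S. S v \<in> A \<and> S u \<in> B} = Pi V ?B"
    using assms by (auto simp: Pi_def)
  then have "measure_pmf.prob (Pi_pmf V d p) {S. S v \<in> A \<and> S u \<in> B} =
      (\<Prod>w\<in>V. measure_pmf.prob (p w) (?B w))"
    using assms(1) by (simp add: measure_Pi_pmf_Pi)
  also have "\<dots> = (\<Prod>w\<in>{u, v}. measure_pmf.prob (p w) (?B w))"
    by (rule prod.mono_neutral_right) (use assms in auto)
  finally show ?thesis using assms by simp
qed

lemma measure_Pi_pmf_component:
  assumes "finite V" "v \<in> V"
  shows "measure_pmf.prob (Pi_pmf V d p) {S. S v \<in> A} = measure_pmf.prob (p v) A"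
proof -
  have "measure_pmf.prob (p v) A = measure_pmf.prob (map_pmf (\<lambda>S. S v) (Pi_pmf V d p)) A"
    using assms by (simp add: Pi_pmf_component)
  then show ?thesis by (simp add: vimage_def)
qed

locale fractional_allocation =
  fixes V :: "'v set" and E :: "'v set set" and \<pi> :: "'v \<Rightarrow> nat" and k \<rho> :: nat
    and y :: "'v \<Rightarrow> nat set \<Rightarrow> real"
  assumes finite_V: "finite V"
    and nonneg: "\<And>v T. v \<in> V \<Longrightarrow> T \<subseteq> {1..k} \<Longrightarrow> 0 \<le> y v T"
    and sum_le_1: "\<And>v. v \<in> V \<Longrightarrow> (\<Sum>T\<in>Pow {1..k}. y v T) \<le> 1"
    and rho: "\<rho> \<ge> 1"
begin

lemma pmf_round:
  "v \<in> V \<Longrightarrow> pmf (round_vertex k \<rho> (y v)) T = round_prob k \<rho> (y v) T"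
  using nonneg sum_le_1 rho by (intro pmf_round_vertex) blast+

lemma set_pmf_round: "v \<in> V \<Longrightarrow> set_pmf (round_vertex k \<rho> (y v)) \<subseteq> Pow {1..k}"
  by (auto simp: set_pmf_eq pmf_round round_prob_def split: if_splits)

lemma set_pmf_rounding_stage:
  "set_pmf (rounding_stage V k \<rho> y) \<subseteq> PiE_dflt V {} (\<lambda>_. Pow {1..k})"
  using finite_V set_pmf_round
  by (force simp: rounding_stage_def set_Pi_pmf PiE_dflt_def)

text \<open>Finite support makes every real-valued function of the outcome integrable, as linearity
  and monotonicity of the expectation require.\<close>

lemma finite_set_pmf_round_and_resolve: "finite (set_pmf (round_and_resolve V E \<pi> k \<rho> vs y))"
proof -
  have "finite (PiE_dflt V {} (\<lambda>_. Pow {1..k}))"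
    using finite_V by (intro finite_PiE_dflt) auto
  from finite_subset[OF set_pmf_rounding_stage this] show ?thesis
    by (simp add: round_and_resolve_def)
qed

lemma feasible_round_and_resolve:
  assumes "vertex_ordering V \<pi>" "set vs = V" "S \<in> set_pmf (round_and_resolve V E \<pi> k \<rho> vs y)"
  shows "feasible_allocation V E k S"
proof -
  obtain S0 where S0: "S0 \<in> set_pmf (rounding_stage V k \<rho> y)"
    "S = resolve_conflicts V E \<pi> vs S0"
    using assms(3) by (auto simp: round_and_resolve_def)
  have "S0 v \<subseteq> {1..k}" if "v \<in> V" for v
    using set_pmf_rounding_stage S0(1) that by (fastforce simp: PiE_dflt_def)
  with feasible_resolve_conflicts assms S0(2) show ?thesis by metis
qed

end

text \<open>The interface shared by the small and the large part. The bound on the conflicting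
  weight is half of the scaling factor \<open>c\<close>, whence the conditional failure probability
  1/2. It is demanded only at bundles of positive weight: this is how the small part obtains a bound
  on \<open>card T\<close>, while at weight 0 the survival estimate is trivial.\<close>

locale low_conflict_allocation = fractional_allocation +
  assumes k_pos: "k \<ge> 1"
    and conflict: "\<And>v T. v \<in> V \<Longrightarrow> T \<subseteq> {1..k} \<Longrightarrow> T \<noteq> {} \<Longrightarrow> 0 < y v T \<Longrightarrow>
      (\<Sum>u\<in>backward_nbrs V E \<pi> v. \<Sum>T'\<in>{T'. T' \<subseteq> {1..k} \<and> T' \<inter> T \<noteq> {}}. y u T')
        \<le> sqrt (real k) * real \<rho>"
begin

abbreviation c :: real where "c \<equiv> 2 * sqrt (real k) * real \<rho>"

lemma c_ge_2: "c \<ge> 2"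
proof -
  have "1 * 1 \<le> sqrt (real k) * real \<rho>"
    by (rule mult_mono) (use k_pos rho in auto)
  then show ?thesis by simp
qed

lemma prob_meets:
  assumes u: "u \<in> V"
  shows "measure_pmf.prob (round_vertex k \<rho> (y u)) {T'. T' \<inter> T \<noteq> {}} =
    (\<Sum>T'\<in>{T'. T' \<subseteq> {1..k} \<and> T' \<inter> T \<noteq> {}}. y u T') / c"
proof -
  let ?p = "round_vertex k \<rho> (y u)" and ?A = "{T'. T' \<subseteq> {1..k} \<and> T' \<inter> T \<noteq> {}}"
  have "measure_pmf.prob ?p {T'. T' \<inter> T \<noteq> {}} = measure_pmf.prob ?p ?A"
    using set_pmf_round[OF u] by (intro measure_prob_cong_0) (auto simp: set_pmf_eq)
  also have "\<dots> = (\<Sum>T'\<in>?A. pmf ?p T')"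
    by (intro measure_measure_pmf_finite) auto
  also have "\<dots> = (\<Sum>T'\<in>?A. y u T' / c)"
    \<comment> \<open>A bundle meeting \<open>T\<close> is nonempty, so the remaining probability
      assigned to the empty bundle never enters.\<close>
    by (intro sum.cong) (auto simp: pmf_round[OF u] round_prob_def)
  finally show ?thesis by (simp add: sum_divide_distrib)
qed

lemma prob_kept_nonempty:
  assumes v: "v \<in> V" and T: "T \<subseteq> {1..k}" "T \<noteq> {}"
  shows "y v T / (2 * c) \<le>
    measure_pmf.prob (rounding_stage V k \<rho> y) {S. resolve_conflicts V E \<pi> vs S v = T}"
proof (cases "0 < y v T")
  case False
  with nonneg[OF v T(1)] have "y v T = 0" by simp
  then show ?thesis by simp
next
  case True
  let ?D = "rounding_stage V k \<rho> y" and ?N = "backward_nbrs V E \<pi> v"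
  let ?bad = "\<lambda>u. {S. S v \<in> {T} \<and> S u \<in> {T'. T' \<inter> T \<noteq> {}}}"
  let ?keep = "{S. resolve_conflicts V E \<pi> vs S v = T}"
  have fin: "finite ?N" and N: "?N \<subseteq> V - {v}"
    using finite_V by (auto simp: backward_nbrs_def)
  have pT: "measure_pmf.prob (round_vertex k \<rho> (y v)) {T} = y v T / c"
    using T by (simp add: measure_pmf_single pmf_round[OF v] round_prob_def)
  have bad: "measure_pmf.prob ?D (?bad u) =
      y v T / c * ((\<Sum>T'\<in>{T'. T' \<subseteq> {1..k} \<and> T' \<inter> T \<noteq> {}}. y u T') / c)" if "u \<in> ?N" for u
  proof -
    have "u \<in> V" "u \<noteq> v" using that N by auto
    then show ?thesis
      unfolding rounding_stage_def using v finite_V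
      by (subst measure_Pi_pmf_pair) (auto simp: prob_meets pT)
  qed
  \<comment> \<open>The chain bounds \<open>y v T / c\<close> by the probability of
    \<open>?keep\<close> plus half of \<open>y v T / c\<close>; subtracting that half gives the
    claim.\<close>
  have "y v T / c = measure_pmf.prob ?D {S. S v \<in> {T}}"
    unfolding rounding_stage_def pT[symmetric]
    by (rule measure_Pi_pmf_component[symmetric]) (use finite_V v in auto)
  also have "\<dots> \<le> measure_pmf.prob ?D (?keep \<union> (\<Union>u\<in>?N. ?bad u))"
  proof (rule measure_pmf.finite_measure_mono)
    \<comment> \<open>Either no backward neighbour meets \<open>T\<close>, and \<open>v\<close>
      survives, or some neighbour witnesses a bad event.\<close>
    show "{S. S v \<in> {T}} \<subseteq> ?keep \<union> (\<Union>u\<in>?N. ?bad u)"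
      using fold_resolve_vertex_survives[of V E \<pi> v _ vs]
      by (fastforce simp: resolve_conflicts_def)
  qed simp
  also have "\<dots> \<le> measure_pmf.prob ?D ?keep + measure_pmf.prob ?D (\<Union>u\<in>?N. ?bad u)"
    by (rule measure_Un_le) auto
  also have "measure_pmf.prob ?D (\<Union>u\<in>?N. ?bad u) \<le> (\<Sum>u\<in>?N. measure_pmf.prob ?D (?bad u))"
    by (rule measure_UNION_le) (use fin in auto)
  also have "\<dots> = y v T / c *
      ((\<Sum>u\<in>?N. \<Sum>T'\<in>{T'. T' \<subseteq> {1..k} \<and> T' \<inter> T \<noteq> {}}. y u T') / c)"
    by (simp only: sum.cong[OF refl bad] sum_distrib_left[symmetric] sum_divide_distrib[symmetric])
  also have "\<dots> \<le> y v T / c * (1 / 2)"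
  proof (rule mult_left_mono)
    show "(\<Sum>u\<in>?N. \<Sum>T'\<in>{T'. T' \<subseteq> {1..k} \<and> T' \<inter> T \<noteq> {}}. y u T') / c \<le> 1 / 2"
      using conflict[OF v T True] c_ge_2 by (subst pos_divide_le_eq) linarith+
  qed (use True c_ge_2 in auto)
  finally show ?thesis by simp
qed

text \<open>The empty bundle may have value and LP weight, yet it is drawn with the remaining
  probability instead of a scaled weight. That probability is at least \<open>1 - 1 / c\<close>,
  which is large enough because \<open>c \<ge> 2\<close>, and an empty bundle stays empty during
  resolution.\<close>

lemma prob_kept_empty:
  assumes v: "v \<in> V"
  shows "y v {} / (2 * c) \<le>
    measure_pmf.prob (rounding_stage V k \<rho> y) {S. resolve_conflicts V E \<pi> vs S v = {}}"
proof -
  have le: "(\<Sum>T'\<in>Pow {1..k} - {{}}. y v T') + y v {} \<le> 1"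
    using sum_le_1[OF v] by (subst (asm) sum.remove[of _ "{}"]) auto
  have ge: "0 \<le> (\<Sum>T'\<in>Pow {1..k} - {{}}. y v T')"
    by (intro sum_nonneg) (auto simp: nonneg v)
  have "y v {} / (2 * c) \<le> 1 / (2 * c)"
    using le ge c_ge_2 by (intro divide_right_mono) auto
  also have "\<dots> \<le> 1 - 1 / c"
    using c_ge_2 by (simp add: field_simps)
  also have "\<dots> \<le> 1 - (\<Sum>T'\<in>Pow {1..k} - {{}}. y v T') / c"
    using le nonneg[OF v, of "{}"] c_ge_2 by (intro diff_left_mono divide_right_mono) auto
  also have "\<dots> = measure_pmf.prob (round_vertex k \<rho> (y v)) {{}}"
    by (simp add: measure_pmf_single pmf_round[OF v] round_prob_def sum_divide_distrib)
  also have "\<dots> = measure_pmf.prob (rounding_stage V k \<rho> y) {S. S v \<in> {{}}}"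
    unfolding rounding_stage_def
    by (rule measure_Pi_pmf_component[symmetric]) (use finite_V v in auto)
  also have "\<dots> \<le> measure_pmf.prob (rounding_stage V k \<rho> y)
      {S. resolve_conflicts V E \<pi> vs S v = {}}"
  proof (rule measure_pmf.finite_measure_mono)
    show "{S. S v \<in> {{}}} \<subseteq> {S. resolve_conflicts V E \<pi> vs S v = {}}"
      using fold_resolve_vertex_subset[of V E \<pi> vs _ v] by (auto simp: resolve_conflicts_def)
  qed simp
  finally show ?thesis .
qed

lemma prob_round_and_resolve:
  assumes "v \<in> V" "T \<subseteq> {1..k}"
  shows "y v T / (2 * c) \<le> measure_pmf.prob (round_and_resolve V E \<pi> k \<rho> vs y) {S. S v = T}"
  using assms prob_kept_nonempty[of v T vs] prob_kept_empty[of v vs]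
  by (cases "T = {}") (auto simp: round_and_resolve_def vimage_def)

lemma expected_welfare:
  "LP_objective V k b y / (2 * c) \<le>
    measure_pmf.expectation (round_and_resolve V E \<pi> k \<rho> vs y) (\<lambda>S. real (social_welfare V b S))"
proof -
  let ?P = "round_and_resolve V E \<pi> k \<rho> vs y"
  let ?f = "\<lambda>S. \<Sum>v\<in>V. \<Sum>T\<in>Pow {1..k}. real (b v T) * indicator {S. S v = T} S"
  note [simp] = integrable_measure_pmf_finite[OF finite_set_pmf_round_and_resolve]
  have "LP_objective V k b y / (2 * c) =
      (\<Sum>v\<in>V. \<Sum>T\<in>Pow {1..k}. real (b v T) * (y v T / (2 * c)))"
    by (simp add: LP_objective_def sum_divide_distrib)
  also have "\<dots> \<le> (\<Sum>v\<in>V. \<Sum>T\<in>Pow {1..k}. real (b v T) * measure_pmf.prob ?P {S. S v = T})"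
    by (intro sum_mono mult_left_mono prob_round_and_resolve) auto
  also have "\<dots> = measure_pmf.expectation ?P ?f"
    by (subst Bochner_Integration.integral_sum, simp, intro sum.cong refl,
        subst Bochner_Integration.integral_sum) simp_all
  also have "\<dots> \<le> measure_pmf.expectation ?P (\<lambda>S. real (social_welfare V b S))"
  proof (rule integral_mono)
    fix S
    \<comment> \<open>Only an inequality is needed: if \<open>S v\<close> is not a subset of
      \<open>{1..k}\<close>, the left side is 0, so no case distinction on the support is
      required.\<close>
    have "(\<Sum>T\<in>Pow {1..k}. real (b v T) * indicator {S. S v = T} S) \<le> real (b v (S v))" for v
    proof -
      have "(\<Sum>T\<in>Pow {1..k}. real (b v T) * indicator {S. S v = T} S) =
          (\<Sum>T\<in>Pow {1..k}. if S v = T then real (b v T) else 0)"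
        by (intro sum.cong) (auto simp: indicator_def)
      then show ?thesis by (simp add: sum.delta')
    qed
    then show "?f S \<le> real (social_welfare V b S)"
      unfolding social_welfare_def of_nat_sum by (rule sum_mono)
  qed auto
  finally show ?thesis .
qed

end

section \<open>The two parts of an LP solution\<close>

text \<open>Double counting of the pairs of a channel \<open>j\<close> and a bundle
  \<open>T'\<close> with \<open>j\<close> in both \<open>T\<close> and \<open>T'\<close>.\<close>

lemma sum_channels_eq:
  fixes f :: "nat set \<Rightarrow> real"
  assumes "finite T"
  shows "(\<Sum>j\<in>T. \<Sum>T'\<in>{T'. T' \<subseteq> {1..k} \<and> j \<in> T'}. f T') =
    (\<Sum>T'\<in>Pow {1..k}. real (card (T \<inter> T')) * f T')"
proof -
  have "(\<Sum>j\<in>T. \<Sum>T'\<in>{T'. T' \<subseteq> {1..k} \<and> j \<in> T'}. f T') =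
      (\<Sum>j\<in>T. \<Sum>T'\<in>{T' \<in> Pow {1..k}. j \<in> T'}. f T')"
    by (intro sum.cong) auto
  also have "\<dots> = (\<Sum>T'\<in>Pow {1..k}. \<Sum>j\<in>{j \<in> T. j \<in> T'}. f T')"
    by (rule sum.swap_restrict) (use assms in auto)
  also have "\<dots> = (\<Sum>T'\<in>Pow {1..k}. real (card (T \<inter> T')) * f T')"
    by (simp add: Int_def)
  finally show ?thesis .
qed

lemma small_part_le: "0 \<le> x v T \<Longrightarrow> small_part k x v T \<le> x v T"
  and large_part_le: "0 \<le> x v T \<Longrightarrow> large_part k x v T \<le> x v T"
  and small_part_nonneg: "0 \<le> x v T \<Longrightarrow> 0 \<le> small_part k x v T"
  and large_part_nonneg: "0 \<le> x v T \<Longrightarrow> 0 \<le> large_part k x v T"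
  by (auto simp: small_part_def large_part_def)

lemma LP_objective_parts:
  "LP_objective V k b x =
    LP_objective V k b (small_part k x) + LP_objective V k b (large_part k x)"
  by (simp add: LP_objective_def large_part_def sum.distrib[symmetric] algebra_simps)

context
  fixes V :: "'v set" and E :: "'v set set" and \<pi> :: "'v \<Rightarrow> nat" and k \<rho> :: nat
    and x :: "'v \<Rightarrow> nat set \<Rightarrow> real"
  assumes finite_V: "finite V" and rho: "\<rho> \<ge> 1" and LP: "LP_feasible V E \<pi> k \<rho> x"
begin

lemma LP_nonneg: "v \<in> V \<Longrightarrow> T \<subseteq> {1..k} \<Longrightarrow> 0 \<le> x v T"
  and LP_sum_le_1: "v \<in> V \<Longrightarrow> (\<Sum>T\<in>Pow {1..k}. x v T) \<le> 1"
  using LP by (auto simp: LP_feasible_def)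

text \<open>The LP constraints at \<open>v\<close> are added over the channels of \<open>T\<close>.
  It is applied with \<open>T\<close> the bundle of \<open>v\<close> for the small part and with
  \<open>T = {1..k}\<close> for the large part.\<close>

lemma LP_sum_channels_le:
  assumes "v \<in> V" "T \<subseteq> {1..k}"
  shows "(\<Sum>u\<in>backward_nbrs V E \<pi> v. \<Sum>T'\<in>Pow {1..k}. real (card (T \<inter> T')) * x u T')
    \<le> real (card T) * real \<rho>"
proof -
  have fin: "finite T" using assms(2) finite_subset by blast
  have "(\<Sum>u\<in>backward_nbrs V E \<pi> v. \<Sum>T'\<in>Pow {1..k}. real (card (T \<inter> T')) * x u T') =
      (\<Sum>j\<in>T. \<Sum>u\<in>backward_nbrs V E \<pi> v. \<Sum>T'\<in>{T'. T' \<subseteq> {1..k} \<and> j \<in> T'}. x u T')"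
    unfolding sum_channels_eq[OF fin, symmetric] by (rule sum.swap)
  also have "\<dots> \<le> (\<Sum>j\<in>T. real \<rho>)"
    using assms LP by (intro sum_mono) (auto simp: LP_feasible_def)
  finally show ?thesis by simp
qed

lemma fractional_allocation_part:
  assumes "\<And>v T. v \<in> V \<Longrightarrow> T \<subseteq> {1..k} \<Longrightarrow> 0 \<le> y v T"
    and le: "\<And>v T. v \<in> V \<Longrightarrow> T \<subseteq> {1..k} \<Longrightarrow> y v T \<le> x v T"
  shows "fractional_allocation V k \<rho> y"
proof
  fix v assume v: "v \<in> V"
  have "(\<Sum>T\<in>Pow {1..k}. y v T) \<le> (\<Sum>T\<in>Pow {1..k}. x v T)"
    by (intro sum_mono le v) auto
  with LP_sum_le_1[OF v] show "(\<Sum>T\<in>Pow {1..k}. y v T) \<le> 1" by simp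
qed (use assms finite_V rho in auto)

lemma fractional_allocation_small_part: "fractional_allocation V k \<rho> (small_part k x)"
  by (intro fractional_allocation_part small_part_le small_part_nonneg LP_nonneg)

lemma fractional_allocation_large_part: "fractional_allocation V k \<rho> (large_part k x)"
  by (intro fractional_allocation_part large_part_le large_part_nonneg LP_nonneg)

lemma low_conflict_small_part:
  assumes "k \<ge> 1"
  shows "low_conflict_allocation V E \<pi> k \<rho> (small_part k x)"
proof -
  interpret fractional_allocation V E \<pi> k \<rho> "small_part k x"
    by (rule fractional_allocation_small_part)
  show ?thesis
  proof
    fix v T assume v: "v \<in> V" and T: "T \<subseteq> {1..k}" and pos: "0 < small_part k x v T"
    have "(\<Sum>u\<in>backward_nbrs V E \<pi> v.
          \<Sum>T'\<in>{T'. T' \<subseteq> {1..k} \<and> T' \<inter> T \<noteq> {}}. small_part k x u T')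
        \<le> (\<Sum>u\<in>backward_nbrs V E \<pi> v. \<Sum>T'\<in>Pow {1..k}. real (card (T \<inter> T')) * x u T')"
    proof (rule sum_mono)
      fix u assume "u \<in> backward_nbrs V E \<pi> v"
      then have u: "u \<in> V" by (simp add: backward_nbrs_def)
      have "small_part k x u T' \<le> real (card (T \<inter> T')) * x u T'"
        if "T' \<subseteq> {1..k}" "T' \<inter> T \<noteq> {}" for T'
      proof -
        \<comment> \<open>A bundle meeting \<open>T\<close> is counted at least once in the sum over
          the channels of \<open>T\<close>.\<close>
        have "finite (T \<inter> T')" using T finite_subset by blast
        then have "card (T \<inter> T') \<ge> 1"
          using that by (auto simp: Suc_le_eq card_gt_0_iff)
        then have "1 * x u T' \<le> real (card (T \<inter> T')) * x u T'"
          using LP_nonneg[OF u that(1)] by (intro mult_right_mono) auto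
        with small_part_le[of x u T' k] LP_nonneg[OF u that(1)] show ?thesis by simp
      qed
      then have "(\<Sum>T'\<in>{T'. T' \<subseteq> {1..k} \<and> T' \<inter> T \<noteq> {}}. small_part k x u T')
          \<le> (\<Sum>T'\<in>{T'. T' \<subseteq> {1..k} \<and> T' \<inter> T \<noteq> {}}. real (card (T \<inter> T')) * x u T')"
        by (intro sum_mono) auto
      also have "\<dots> \<le> (\<Sum>T'\<in>Pow {1..k}. real (card (T \<inter> T')) * x u T')"
        by (rule sum_mono2) (auto intro!: mult_nonneg_nonneg simp: LP_nonneg[OF u, simplified])
      finally show "(\<Sum>T'\<in>{T'. T' \<subseteq> {1..k} \<and> T' \<inter> T \<noteq> {}}. small_part k x u T')
          \<le> (\<Sum>T'\<in>Pow {1..k}. real (card (T \<inter> T')) * x u T')" .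
    qed
    also have "\<dots> \<le> real (card T) * real \<rho>"
      by (rule LP_sum_channels_le[OF v T])
    \<comment> \<open>Positive weight in the small part forces
      \<open>card T \<le> sqrt k\<close>.\<close>
    also have "\<dots> \<le> sqrt (real k) * real \<rho>"
      using pos by (intro mult_right_mono) (auto simp: small_part_def split: if_splits)
    finally show "(\<Sum>u\<in>backward_nbrs V E \<pi> v.
        \<Sum>T'\<in>{T'. T' \<subseteq> {1..k} \<and> T' \<inter> T \<noteq> {}}. small_part k x u T')
      \<le> sqrt (real k) * real \<rho>" .
  qed (use assms in auto)
qed

lemma low_conflict_large_part:
  assumes "k \<ge> 1"
  shows "low_conflict_allocation V E \<pi> k \<rho> (large_part k x)"
proof -
  interpret fractional_allocation V E \<pi> k \<rho> "large_part k x"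
    by (rule fractional_allocation_large_part)
  show ?thesis
  proof
    fix v T assume v: "v \<in> V"
    let ?L = "\<Sum>u\<in>backward_nbrs V E \<pi> v.
        \<Sum>T'\<in>{T'. T' \<subseteq> {1..k} \<and> T' \<inter> T \<noteq> {}}. large_part k x u T'"
    \<comment> \<open>Scaling by \<open>sqrt k\<close> allows comparison with the multiplicity
      \<open>card T'\<close>, which exceeds \<open>sqrt k\<close> wherever the large part is
      nonzero. The bundle \<open>T\<close> of \<open>v\<close> only restricts the sum, so the
      estimate is uniform in \<open>T\<close>.\<close>
    have "sqrt (real k) * ?L =
        (\<Sum>u\<in>backward_nbrs V E \<pi> v.
          \<Sum>T'\<in>{T'. T' \<subseteq> {1..k} \<and> T' \<inter> T \<noteq> {}}. sqrt (real k) * large_part k x u T')"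
      by (simp add: sum_distrib_left)
    also have "\<dots> \<le> (\<Sum>u\<in>backward_nbrs V E \<pi> v.
        \<Sum>T'\<in>Pow {1..k}. real (card ({1..k} \<inter> T')) * x u T')"
    proof (rule sum_mono)
      fix u assume "u \<in> backward_nbrs V E \<pi> v"
      then have u: "u \<in> V" by (simp add: backward_nbrs_def)
      have "sqrt (real k) * large_part k x u T' \<le> real (card ({1..k} \<inter> T')) * x u T'"
        if "T' \<subseteq> {1..k}" for T'
      proof -
        have "{1..k} \<inter> T' = T'" using that by blast
        then show ?thesis
          using LP_nonneg[OF u that]
          by (auto simp: large_part_def small_part_def intro!: mult_right_mono)
      qed
      then have "(\<Sum>T'\<in>{T'. T' \<subseteq> {1..k} \<and> T' \<inter> T \<noteq> {}}. sqrt (real k) * large_part k x u T')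
          \<le> (\<Sum>T'\<in>{T'. T' \<subseteq> {1..k} \<and> T' \<inter> T \<noteq> {}}. real (card ({1..k} \<inter> T')) * x u T')"
        by (intro sum_mono) auto
      also have "\<dots> \<le> (\<Sum>T'\<in>Pow {1..k}. real (card ({1..k} \<inter> T')) * x u T')"
        by (rule sum_mono2) (auto intro!: mult_nonneg_nonneg simp: LP_nonneg[OF u, simplified])
      finally show "(\<Sum>T'\<in>{T'. T' \<subseteq> {1..k} \<and> T' \<inter> T \<noteq> {}}. sqrt (real k) * large_part k x u T')
          \<le> (\<Sum>T'\<in>Pow {1..k}. real (card ({1..k} \<inter> T')) * x u T')" .
    qed
    also have "\<dots> \<le> real (card {1..k}) * real \<rho>"
      by (rule LP_sum_channels_le[OF v]) simp
    \<comment> \<open>Splitting \<open>k\<close> as a square lets the positive factor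
      \<open>sqrt k\<close> cancel.\<close>
    also have "\<dots> = sqrt (real k) * (sqrt (real k) * real \<rho>)"
      by (simp add: mult.assoc[symmetric])
    finally show "?L \<le> sqrt (real k) * real \<rho>"
      using assms by simp
  qed (use assms in auto)
qed

end

section \<open>The better of two allocations\<close>

text \<open>Puts both runs on one product space, where their welfares can be compared
  pointwise.\<close>

lemma LP_rounding_eq_map_pair:
  "LP_rounding V E \<pi> k \<rho> b vs1 vs2 x =
    map_pmf (\<lambda>(S1, S2). arg_max_on (social_welfare V b) {S1, S2})
      (pair_pmf (round_and_resolve V E \<pi> k \<rho> vs1 (small_part k x))
        (round_and_resolve V E \<pi> k \<rho> vs2 (large_part k x)))"
  by (simp add: LP_rounding_def pair_pmf_def map_bind_pmf)

lemma arg_max_on_pair: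
  fixes f :: "'a \<Rightarrow> nat"
  shows "arg_max_on f {a, b} \<in> {a, b}"
    and "f a \<le> f (arg_max_on f {a, b})" and "f b \<le> f (arg_max_on f {a, b})"
proof -
  have "arg_max_on f {a, b} \<in> {a, b} \<and> (\<forall>y. y \<in> {a, b} \<longrightarrow> f y \<le> f (arg_max_on f {a, b}))"
    \<comment> \<open>The rule asks for a strict upper bound on the values, hence the
      \<open>Suc\<close>.\<close>
    unfolding arg_max_on_def by (rule arg_max_nat_lemma[of _ a _ "Suc (max (f a) (f b))"]) auto
  then show "arg_max_on f {a, b} \<in> {a, b}"
    and "f a \<le> f (arg_max_on f {a, b})" and "f b \<le> f (arg_max_on f {a, b})"
    by auto
qed

theorem theorem1:
  fixes V :: "'v set" and E :: "'v set set" and \<pi> :: "'v \<Rightarrow> nat" and \<rho> k :: nat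
    and b :: "'v \<Rightarrow> nat set \<Rightarrow> nat" and x :: "'v \<Rightarrow> nat set \<Rightarrow> real"
    and vs1 vs2 :: "'v list"
  assumes "simple_graph V E"
    and "\<rho> = inductive_independence_number V E" and "\<rho> \<ge> 1"
    and "ordering_bounded_by V E \<pi> \<rho>"
    and "LP_feasible V E \<pi> k \<rho> x"
    and "visiting_order V vs1" and "visiting_order V vs2"
  shows "(\<forall>S \<in> set_pmf (LP_rounding V E \<pi> k \<rho> b vs1 vs2 x). feasible_allocation V E k S) \<and>
         measure_pmf.expectation (LP_rounding V E \<pi> k \<rho> b vs1 vs2 x)
           (\<lambda>S. real (social_welfare V b S))
         \<ge> LP_objective V k b x / (8 * sqrt (real k) * real \<rho>)"
proof
  have V: "finite V" using assms(1) by (simp add: simple_graph_def)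
  have ord: "vertex_ordering V \<pi>" using assms(4) by (simp add: ordering_bounded_by_def)
  have vs: "set vs1 = V" "set vs2 = V" using assms(6,7) by (auto simp: visiting_order_def)
  interpret small: fractional_allocation V E \<pi> k \<rho> "small_part k x"
    by (rule fractional_allocation_small_part[OF V assms(3,5)])
  interpret large: fractional_allocation V E \<pi> k \<rho> "large_part k x"
    by (rule fractional_allocation_large_part[OF V assms(3,5)])
  let ?P1 = "round_and_resolve V E \<pi> k \<rho> vs1 (small_part k x)"
  let ?P2 = "round_and_resolve V E \<pi> k \<rho> vs2 (large_part k x)"
  let ?P = "LP_rounding V E \<pi> k \<rho> b vs1 vs2 x"
  let ?w = "social_welfare V b"

  show "\<forall>S \<in> set_pmf ?P. feasible_allocation V E k S"
  proof
    fix S assume "S \<in> set_pmf ?P"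
    then obtain S1 S2 where "S1 \<in> set_pmf ?P1" "S2 \<in> set_pmf ?P2" "S = arg_max_on ?w {S1, S2}"
      by (auto simp: LP_rounding_eq_map_pair)
    then show "feasible_allocation V E k S"
      using arg_max_on_pair(1)[of ?w S1 S2]
        small.feasible_round_and_resolve[OF ord vs(1)] large.feasible_round_and_resolve[OF ord vs(2)]
      by auto
  qed

  show "LP_objective V k b x / (8 * sqrt (real k) * real \<rho>) \<le>
      measure_pmf.expectation ?P (\<lambda>S. real (?w S))"
  proof (cases "k = 0")
    case True
    \<comment> \<open>Here the denominator is 0, so the quotient is 0 by convention and
      nonnegativity of the welfare suffices.\<close>
    then show ?thesis by (simp add: integral_nonneg_AE)
  next
    case False
    then have k: "k \<ge> 1" by simp
    interpret small: low_conflict_allocation V E \<pi> k \<rho> "small_part k x"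
      by (rule low_conflict_small_part[OF V assms(3,5) k])
    interpret large: low_conflict_allocation V E \<pi> k \<rho> "large_part k x"
      by (rule low_conflict_large_part[OF V assms(3,5) k])
    have "finite (set_pmf (pair_pmf ?P1 ?P2))"
      using small.finite_set_pmf_round_and_resolve large.finite_set_pmf_round_and_resolve by simp
    note [simp] = integrable_measure_pmf_finite[OF this]
    \<comment> \<open>The constant 8 is a product of three factors 2: from the scaling
      \<open>c\<close>, from survival with conditional probability at least 1/2, and from averaging
      the two runs.\<close>
    have "LP_objective V k b x / (8 * sqrt (real k) * real \<rho>) =
        (LP_objective V k b (small_part k x) / (2 * small.c) +
         LP_objective V k b (large_part k x) / (2 * small.c)) / 2"
      by (simp add: LP_objective_parts[of V k b x] add_divide_distrib)
    also have "\<dots> \<le> (measure_pmf.expectation ?P1 (\<lambda>S. real (?w S)) +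
        measure_pmf.expectation ?P2 (\<lambda>S. real (?w S))) / 2"
      by (intro divide_right_mono add_mono small.expected_welfare large.expected_welfare) simp
    also have "\<dots> = measure_pmf.expectation (pair_pmf ?P1 ?P2)
        (\<lambda>S. (real (?w (fst S)) + real (?w (snd S))) / 2)"
      by (simp add: expectation_pair_pmf_fst[of _ _ "\<lambda>S. real (?w S)"]
          expectation_pair_pmf_snd[of _ _ "\<lambda>S. real (?w S)"])
    also have "\<dots> \<le> measure_pmf.expectation (pair_pmf ?P1 ?P2)
        (\<lambda>S. real (?w (arg_max_on ?w {fst S, snd S})))"
    proof (rule integral_mono)
      fix S
      \<comment> \<open>The better of the two welfares is at least their average, for each pair of
        outcomes.\<close>
      have average_le: "(real p + real q) / 2 \<le> real m" if "p \<le> m" "q \<le> m" for p q m :: nat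
        using that by simp
      show "(real (?w (fst S)) + real (?w (snd S))) / 2
          \<le> real (?w (arg_max_on ?w {fst S, snd S}))"
        by (intro average_le arg_max_on_pair[of ?w])
    qed auto
    also have "\<dots> = measure_pmf.expectation ?P (\<lambda>S. real (?w S))"
      by (simp add: LP_rounding_eq_map_pair case_prod_unfold)
    finally show ?thesis .
  qed
qed

end
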